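(* Let $\Omega\subset\mathbb C^n$ be $\mathcal F$-open. Every strongly $\mathcal F$-holomorphic function $f:\Omega\to\mathbb C$ is weakly $\mathcal F$-holomorphic, and in particular $\mathcal F$-continuous.
   Context: The plurifine topology $\mathcal F$ on $\mathbb C^n$ is the coarsest topology making all plurisubharmonic functions on $\mathbb C^n$ continuous; the prefix "$\mathcal F$-" refers to it, and topological terms without prefix (e.g. compact, open) refer to the Euclidean topology. The (Cartan) fine topology on $\mathbb C\cong\mathbb R^2$ is the coarsest topology making all subharmonic functions on $\mathbb C$ continuous; it coincides with $\mathcal F$ for $n=1$. For compact $K\subset\mathbb C^n$ let $H_0(K)$ be the algebra of restrictions to $K$ of holomorphic functions defined on open subsets of $\mathbb C^n$ containing $K$, and $H(K)$ its closure in $C(K,\mathbb C)$ with the uniform norm. A function $f:\Omega\to\mathbb C$ is strongly $\mathcal F$-holomorphic if every point of $\Omega$ has a compact $\mathcal F$-neighborhood $K\subset\Omega$ such that $f|_K\in H(K)$. A function $f:U\to\mathbb C$ on a finely open set $U\subset\mathbb C$ is finely holomorphic if every point of $U$ has a compact fine neighborhood $K\subset U$ such that $f|_K$ is a uniform limit on $K$ of rational functions with poles off $K$. A function $f:\Omega\to\mathbb C$ is weakly $\mathcal F$-holomorphic if $f$ is $\mathcal F$-continuous and for every complex (affine) line $L\cong\mathbb C$ in $\mathbb C^n$ the restriction of $f$ to the finely open subset $L\cap\Omega$ of $L$ is finely holomorphic. *)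

theory Defs
  imports "HOL-Analysis.Analysis" "HOL-Computational_Algebra.Polynomial"
begin

definition coarsest_topology :: "('a \<Rightarrow> 'b::topological_space) set \<Rightarrow> 'a topology" where
  "coarsest_topology F = topology_generated_by {u -` V | u V. u \<in> F \<and> open V}"

lemma continuous_map_coarsest_topology:
  assumes "u \<in> F"
  shows "continuous_map (coarsest_topology F) euclidean u"
proof -
  have "openin (coarsest_topology F) (u -` V)" if "open V" for V
    unfolding coarsest_topology_def
    using assms that by (intro topology_generated_by_Basis) blast
  moreover from this[OF open_UNIV] have "topspace (coarsest_topology F) = UNIV"
    using openin_subset by fastforce
  ultimately show ?thesis
    by (auto simp: continuous_map_alt vimage_def)
qed

lemma coarsest_topology_least:
  assumes "topspace T = UNIV" "\<And>u. u \<in> F \<Longrightarrow> continuous_map T euclidean u"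
    and "openin (coarsest_topology F) W"
  shows "openin T W"
proof -
  have "generate_topology_on {u -` V | u V. u \<in> F \<and> open V} W"
    using assms(3) by (simp add: coarsest_topology_def openin_topology_generated_by)
  then show ?thesis
  proof induction
    case (Basis s)
    then obtain u V where "s = u -` V" "u \<in> F" "open V" by blast
    with assms(1,2) show ?case by (auto simp: continuous_map_alt)
  qed auto
qed

definition upper_semicontinuous :: "('a::topological_space \<Rightarrow> ereal) \<Rightarrow> bool" where
  "upper_semicontinuous u \<longleftrightarrow> (\<forall>c. open {z. u z < c})"

(* The integral is taken as positive part minus negative part, since e2ennreal truncates
   negative values to 0.  For upper semicontinuous u < \<infinity> the positive part is bounded on the
   circle, so \<infinity> - \<infinity> does not occur. *)
definition circle_mean :: "(complex \<Rightarrow> ereal) \<Rightarrow> complex \<Rightarrow> real \<Rightarrow> ereal" where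
  "circle_mean u z r =
     (enn2ereal (\<integral>\<^sup>+t\<in>{0..2*pi}. e2ennreal (u (z + of_real r * cis t)) \<partial>lborel)
      - enn2ereal (\<integral>\<^sup>+t\<in>{0..2*pi}. e2ennreal (- u (z + of_real r * cis t)) \<partial>lborel))
     / ereal (2 * pi)"

(* The constant -\<infinity> counts as (pluri)subharmonic.  This convention does not affect the
   topologies generated below, as constant functions are always continuous. *)
definition subharmonic :: "(complex \<Rightarrow> ereal) \<Rightarrow> bool" where
  "subharmonic u \<longleftrightarrow> upper_semicontinuous u \<and> (\<forall>z. u z < \<infinity>) \<and>
     (\<forall>z r. r > 0 \<longrightarrow> u z \<le> circle_mean u z r)"

definition plurisubharmonic :: "(complex^'n \<Rightarrow> ereal) \<Rightarrow> bool" where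
  "plurisubharmonic u \<longleftrightarrow> upper_semicontinuous u \<and> (\<forall>z. u z < \<infinity>) \<and>
     (\<forall>a b. subharmonic (\<lambda>\<zeta>. u (a + \<zeta> *s b)))"

definition fine_topology :: "complex topology" where
  "fine_topology = coarsest_topology {u. subharmonic u}"

definition plurifine_topology :: "(complex^'n) topology" where
  "plurifine_topology = coarsest_topology {u. plurisubharmonic u}"

definition holomorphic_Cn_on :: "(complex^'n \<Rightarrow> complex) \<Rightarrow> (complex^'n) set \<Rightarrow> bool" where
  "holomorphic_Cn_on f U \<longleftrightarrow>
     (\<forall>z\<in>U. \<exists>D. (f has_derivative D) (at z) \<and> (\<forall>c v. D (c *s v) = c * D v))"

(* Elements of the function algebras on K are represented by total functions of which only
   the values on K matter. *)
definition H0_alg :: "(complex^'n) set \<Rightarrow> (complex^'n \<Rightarrow> complex) set" where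
  "H0_alg K = {g. \<exists>U h. open U \<and> K \<subseteq> U \<and> holomorphic_Cn_on h U \<and> (\<forall>z\<in>K. g z = h z)}"

definition H_alg :: "(complex^'n) set \<Rightarrow> (complex^'n \<Rightarrow> complex) set" where
  "H_alg K = {f. continuous_on K f \<and> (\<forall>e>0. \<exists>g\<in>H0_alg K. \<forall>z\<in>K. dist (g z) (f z) < e)}"

definition strongly_F_holomorphic :: "(complex^'n \<Rightarrow> complex) \<Rightarrow> (complex^'n) set \<Rightarrow> bool" where
  "strongly_F_holomorphic f \<Omega> \<longleftrightarrow>
     (\<forall>z\<in>\<Omega>. \<exists>K. compact K \<and> z \<in> plurifine_topology interior_of K \<and> K \<subseteq> \<Omega> \<and> f \<in> H_alg K)"

definition rational_poles_off :: "complex set \<Rightarrow> (complex \<Rightarrow> complex) set" where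
  "rational_poles_off K = {\<lambda>z. poly p z / poly q z | p q. \<forall>z\<in>K. poly q z \<noteq> 0}"

definition finely_holomorphic :: "(complex \<Rightarrow> complex) \<Rightarrow> complex set \<Rightarrow> bool" where
  "finely_holomorphic f U \<longleftrightarrow> openin fine_topology U \<and>
     (\<forall>z\<in>U. \<exists>K. compact K \<and> z \<in> fine_topology interior_of K \<and> K \<subseteq> U \<and>
        (\<exists>R. (\<forall>k. R k \<in> rational_poles_off K) \<and> uniform_limit K R f sequentially))"

definition F_continuous :: "(complex^'n \<Rightarrow> complex) \<Rightarrow> (complex^'n) set \<Rightarrow> bool" where
  "F_continuous f \<Omega> \<longleftrightarrow> continuous_map (subtopology plurifine_topology \<Omega>) euclidean f"

(* Each complex line is identified with the complex plane through its affine
   parametrizations \<zeta> \<mapsto> a + \<zeta> b with b \<noteq> 0. *)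
definition weakly_F_holomorphic :: "(complex^'n \<Rightarrow> complex) \<Rightarrow> (complex^'n) set \<Rightarrow> bool" where
  "weakly_F_holomorphic f \<Omega> \<longleftrightarrow> F_continuous f \<Omega> \<and>
     (\<forall>a b. b \<noteq> 0 \<longrightarrow> finely_holomorphic (\<lambda>\<zeta>. f (a + \<zeta> *s b)) {\<zeta>. a + \<zeta> *s b \<in> \<Omega>})"

end

(*  Both conclusions are local. The plurifine topology refines the Euclidean one, because real-linear
    functionals are plurisubharmonic, so continuity of f on the compact plurifine neighborhoods K
    gives plurifine continuity. A complex line meets K in a compact set, which is a fine
    neighborhood in the line since plurisubharmonic functions restrict to subharmonic ones. There f
    is a uniform limit of functions of one variable holomorphic near that set, and by Runge's
    theorem these are uniform limits of rational functions with poles off the set.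

    For Runge's theorem, cover K by the squares of a fine grid that meet K. The Cauchy integral over
    the edges that are not shared by two such squares reproduces the function on K, also on grid
    lines by continuity, and Riemann sums of this integral are rational.  *)

theory Submission
  imports Defs "HOL-Complex_Analysis.Cauchy_Integral_Formula"
begin

section \<open>Rational functions with poles off a set\<close>

lemma rational_poles_offI:
  assumes "\<And>z. z \<in> K \<Longrightarrow> poly q z \<noteq> 0"
  shows "(\<lambda>z. poly p z / poly q z) \<in> rational_poles_off K"
  unfolding rational_poles_off_def using assms by blast

text \<open>Equality is asked for only on \<open>K\<close>: since division by zero gives 0, the
  quotient over the common denominator may differ from the sum at a pole of one summand.\<close>

lemma rational_poles_off_add:
  assumes "r \<in> rational_poles_off K" "s \<in> rational_poles_off K"
  obtains t where "t \<in> rational_poles_off K" "\<And>z. z \<in> K \<Longrightarrow> t z = r z + s z"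
proof -
  obtain p q where pq: "r = (\<lambda>z. poly p z / poly q z)" "\<forall>z\<in>K. poly q z \<noteq> 0"
    using assms(1) by (auto simp: rational_poles_off_def)
  obtain p' q' where pq': "s = (\<lambda>z. poly p' z / poly q' z)" "\<forall>z\<in>K. poly q' z \<noteq> 0"
    using assms(2) by (auto simp: rational_poles_off_def)
  show ?thesis
  proof
    show "(\<lambda>z. poly (p * q' + p' * q) z / poly (q * q') z) \<in> rational_poles_off K"
      using pq(2) pq'(2) by (intro rational_poles_offI) auto
    show "poly (p * q' + p' * q) z / poly (q * q') z = r z + s z" if "z \<in> K" for z
      using that pq pq' by (simp add: field_simps)
  qed
qed

lemma rational_poles_off_simple_pole:
  assumes "w \<notin> K"
  shows "(\<lambda>z. c / (w - z)) \<in> rational_poles_off K"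
  using rational_poles_offI[of K "[:w, -1:]" "[:c:]"] assms by fastforce

lemma rational_poles_off_cmult:
  assumes "r \<in> rational_poles_off K"
  shows "(\<lambda>z. c * r z) \<in> rational_poles_off K"
proof -
  obtain p q where "r = (\<lambda>z. poly p z / poly q z)" "\<forall>z\<in>K. poly q z \<noteq> 0"
    using assms by (auto simp: rational_poles_off_def)
  then show ?thesis
    using rational_poles_offI[of K q "smult c p"] by simp
qed

section \<open>Uniform rational approximation\<close>

text \<open>For compact \<open>K\<close> this is membership of the restriction to \<open>K\<close>
  in the uniform algebra usually written R(K).\<close>

definition rationally_approximable :: "complex set \<Rightarrow> (complex \<Rightarrow> complex) \<Rightarrow> bool" where
  "rationally_approximable K g \<longleftrightarrow>
     (\<forall>e>0. \<exists>r\<in>rational_poles_off K. \<forall>z\<in>K. dist (r z) (g z) \<le> e)"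

lemma rationally_approximable_zero: "rationally_approximable K (\<lambda>z. 0)"
proof -
  have "(\<lambda>z. 0) \<in> rational_poles_off K"
    using rational_poles_offI[of K 1 0] by simp
  then show ?thesis
    unfolding rationally_approximable_def by force
qed

lemma rationally_approximable_add:
  assumes "rationally_approximable K g" "rationally_approximable K h"
  shows "rationally_approximable K (\<lambda>z. g z + h z)"
  unfolding rationally_approximable_def
proof (intro allI impI)
  fix e :: real assume "e > 0"
  then have "e / 2 > 0" by simp
  with assms obtain r s where r: "r \<in> rational_poles_off K" "\<forall>z\<in>K. dist (r z) (g z) \<le> e / 2"
    and s: "s \<in> rational_poles_off K" "\<forall>z\<in>K. dist (s z) (h z) \<le> e / 2"
    unfolding rationally_approximable_def by meson
  obtain t where t: "t \<in> rational_poles_off K" "\<And>z. z \<in> K \<Longrightarrow> t z = r z + s z"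
    using rational_poles_off_add r(1) s(1) by blast
  have "dist (t z) (g z + h z) \<le> e" if "z \<in> K" for z
  proof -
    have "dist (t z) (g z + h z) \<le> dist (r z) (g z) + dist (s z) (h z)"
      using t(2)[OF that] by (simp add: dist_triangle_add)
    also have "\<dots> \<le> e / 2 + e / 2"
      using r s that by (intro add_mono) auto
    finally show ?thesis by simp
  qed
  with t(1) show "\<exists>r\<in>rational_poles_off K. \<forall>z\<in>K. dist (r z) (g z + h z) \<le> e" by blast
qed

lemma rationally_approximable_cmult:
  assumes "rationally_approximable K g"
  shows "rationally_approximable K (\<lambda>z. c * g z)"
  unfolding rationally_approximable_def
proof (intro allI impI)
  fix e :: real assume e: "e > 0"
  \<comment> \<open>The added 1 keeps the denominator positive when \<open>c = 0\<close>.\<close>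
  then have "e / (norm c + 1) > 0"
    by (simp add: add_nonneg_pos)
  with assms obtain r where r: "r \<in> rational_poles_off K" "\<forall>z\<in>K. dist (r z) (g z) \<le> e / (norm c + 1)"
    unfolding rationally_approximable_def by meson
  have "dist (c * r z) (c * g z) \<le> e" if "z \<in> K" for z
  proof -
    have "dist (c * r z) (c * g z) = norm c * dist (r z) (g z)"
      by (simp add: dist_norm norm_mult flip: right_diff_distrib)
    also have "\<dots> \<le> (norm c + 1) * (e / (norm c + 1))"
      using r that by (intro mult_mono) auto
    also have "\<dots> = e"
      using norm_ge_zero[of c] by (simp add: add_nonneg_eq_0_iff)
    finally show ?thesis .
  qed
  then show "\<exists>r\<in>rational_poles_off K. \<forall>z\<in>K. dist (r z) (c * g z) \<le> e"
    by (intro bexI[OF _ rational_poles_off_cmult[OF r(1), of c]] ballI)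
qed

lemma rationally_approximable_sum:
  assumes "\<And>i. i \<in> I \<Longrightarrow> rationally_approximable K (g i)"
  shows "rationally_approximable K (\<lambda>z. \<Sum>i\<in>I. g i z)"
  using assms
proof (induction I rule: infinite_finite_induct)
  case (insert i I)
  then show ?case using rationally_approximable_add[of K "g i"] by simp
qed (simp_all add: rationally_approximable_zero)

text \<open>Riemann sums in \<open>t\<close> are rational in \<open>z\<close>, and uniform
  continuity on the compact product makes their error small for all \<open>z\<close> in
  \<open>K\<close> at once. Bisection by \<open>Bolzano\<close> replaces explicit
  partitions.\<close>

lemma rationally_approximable_integral:
  fixes G :: "real \<times> complex \<Rightarrow> complex"
  assumes "compact K" "continuous_on ({0..1} \<times> K) G"
    and rat: "\<And>t. t \<in> {0..1} \<Longrightarrow> (\<lambda>z. G (t, z)) \<in> rational_poles_off K"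
  shows "rationally_approximable K (\<lambda>z. integral {0..1} (\<lambda>t. G (t, z)))"
  unfolding rationally_approximable_def
proof (intro allI impI)
  fix e :: real assume e: "e > 0"
  have "uniformly_continuous_on ({0..1} \<times> K) G"
    using assms(1,2) by (intro compact_uniformly_continuous compact_Times) auto
  then obtain d where d: "d > 0" "\<And>x y. x \<in> {0..1} \<times> K \<Longrightarrow> y \<in> {0..1} \<times> K \<Longrightarrow> dist y x < d \<Longrightarrow> dist (G y) (G x) < e"
    unfolding uniformly_continuous_on_def using e by meson
  have cont: "continuous_on {a..b} (\<lambda>t. G (t, z))" if "0 \<le> a" "b \<le> 1" "z \<in> K" for a b z
    by (rule continuous_on_compose2[OF assms(2)]) (use that in \<open>auto intro!: continuous_intros\<close>)
  \<comment> \<open>An error bound proportional to the length of the interval adds up when two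
    adjacent intervals are joined.\<close>
  define P where "P = (\<lambda>a b. 0 \<le> a \<and> b \<le> 1 \<longrightarrow> (\<exists>r\<in>rational_poles_off K. \<forall>z\<in>K.
          dist (r z) (integral {a..b} (\<lambda>t. G (t, z))) \<le> e * (b - a)))"
  have "P 0 1"
  proof (rule Bolzano[where P = P])
    fix a b c :: real assume trans: "P a b" "P b c" "a \<le> b" "b \<le> c"
    show "P a c"
      unfolding P_def
    proof
      assume ac: "0 \<le> a \<and> c \<le> 1"
      then obtain r s where r: "r \<in> rational_poles_off K"
          "\<forall>z\<in>K. dist (r z) (integral {a..b} (\<lambda>t. G (t, z))) \<le> e * (b - a)"
        and s: "s \<in> rational_poles_off K"
          "\<forall>z\<in>K. dist (s z) (integral {b..c} (\<lambda>t. G (t, z))) \<le> e * (c - b)"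
        using trans unfolding P_def by force
      obtain t where t: "t \<in> rational_poles_off K" "\<And>z. z \<in> K \<Longrightarrow> t z = r z + s z"
        using rational_poles_off_add r(1) s(1) by blast
      have "dist (t z) (integral {a..c} (\<lambda>t. G (t, z))) \<le> e * (c - a)" if z: "z \<in> K" for z
      proof -
        have "integral {a..c} (\<lambda>t. G (t, z)) = integral {a..b} (\<lambda>t. G (t, z)) + integral {b..c} (\<lambda>t. G (t, z))"
          using trans ac z cont
          by (intro Henstock_Kurzweil_Integration.integral_combine[symmetric] integrable_continuous_interval) auto
        then have "dist (t z) (integral {a..c} (\<lambda>t. G (t, z)))
            \<le> dist (r z) (integral {a..b} (\<lambda>t. G (t, z))) + dist (s z) (integral {b..c} (\<lambda>t. G (t, z)))"
          using t(2)[OF z] by (simp add: dist_triangle_add)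
        also have "\<dots> \<le> e * (b - a) + e * (c - b)"
          using r s z by (intro add_mono) auto
        finally show ?thesis by (simp add: algebra_simps)
      qed
      with t(1) show "\<exists>r\<in>rational_poles_off K. \<forall>z\<in>K.
          dist (r z) (integral {a..c} (\<lambda>t. G (t, z))) \<le> e * (c - a)" by blast
    qed
  next
    fix x :: real
    show "\<exists>d>0. \<forall>a b. a \<le> x \<and> x \<le> b \<and> b - a < d \<longrightarrow> P a b"
      unfolding P_def
    proof (intro exI conjI allI impI)
      show "d > 0" by fact
      fix a b assume ab: "a \<le> x \<and> x \<le> b \<and> b - a < d" and "0 \<le> a \<and> b \<le> 1"
      then have range: "0 \<le> a" "b \<le> 1" by auto
      \<comment> \<open>A single Riemann term sampled at \<open>x\<close> suffices, because every
        \<open>t\<close> in the interval is within \<open>d\<close> of \<open>x\<close>.\<close>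
      have "dist (of_real (b - a) * G (x, z)) (integral {a..b} (\<lambda>t. G (t, z))) \<le> e * (b - a)"
        if z: "z \<in> K" for z
      proof -
        have int: "(\<lambda>t. G (t, z)) integrable_on {a..b}"
          by (intro integrable_continuous_interval cont range z)
        have "norm (integral {a..b} (\<lambda>t. G (t, z) - G (x, z))) \<le> e * (b - a)"
        proof (rule integral_bound)
          show "a \<le> b" using ab by simp
          show "continuous_on {a..b} (\<lambda>t. G (t, z) - G (x, z))"
            by (intro continuous_intros cont range z)
          show "norm (G (t, z) - G (x, z)) \<le> e" if "t \<in> {a..b}" for t
            using d(2)[of "(x, z)" "(t, z)"] that ab range z
            by (auto simp: dist_Pair_Pair dist_norm intro: less_imp_le)
        qed
        moreover have "integral {a..b} (\<lambda>t. G (t, z) - G (x, z))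
            = integral {a..b} (\<lambda>t. G (t, z)) - of_real (b - a) * G (x, z)"
          using ab by (subst Henstock_Kurzweil_Integration.integral_diff[OF int]) (auto simp: scaleR_conv_of_real)
        ultimately show ?thesis
          by (simp add: dist_norm norm_minus_commute)
      qed
      moreover have "(\<lambda>z. of_real (b - a) * G (x, z)) \<in> rational_poles_off K"
        using ab range by (intro rational_poles_off_cmult rat) auto
      ultimately show "\<exists>r\<in>rational_poles_off K. \<forall>z\<in>K.
          dist (r z) (integral {a..b} (\<lambda>t. G (t, z))) \<le> e * (b - a)"
        by (intro bexI[of _ "\<lambda>z. of_real (b - a) * G (x, z)"] ballI)
    qed
  qed simp
  then show "\<exists>r\<in>rational_poles_off K. \<forall>z\<in>K. dist (r z) (integral {0..1} (\<lambda>t. G (t, z))) \<le> e"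
    by (simp add: P_def)
qed

section \<open>Cauchy integrals over segments and rectangles\<close>

definition cauchy_segment :: "(complex \<Rightarrow> complex) \<Rightarrow> complex \<Rightarrow> complex \<Rightarrow> complex \<Rightarrow> complex" where
  "cauchy_segment f a b z = contour_integral (linepath a b) (\<lambda>w. f w / (w - z))"

text \<open>For fixed \<open>t\<close> the integrand is a simple fraction in \<open>z\<close> whose
  only possible pole lies on the segment, hence off \<open>K\<close>.\<close>

lemma rationally_approximable_cauchy_segment:
  assumes "compact K" "closed_segment a b \<inter> K = {}" "continuous_on (closed_segment a b) f"
  shows "rationally_approximable K (cauchy_segment f a b)"
proof -
  define G where "G = (\<lambda>(t, z). f (linepath a b t) / (linepath a b t - z) * (b - a))"
  have seg: "linepath a b t \<in> closed_segment a b" if "0 \<le> t" "t \<le> 1" for t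
    using that by (simp add: linepath_in_path)
  have "rationally_approximable K (\<lambda>z. integral {0..1} (\<lambda>t. G (t, z)))"
  proof (rule rationally_approximable_integral)
    show "continuous_on ({0..1} \<times> K) G"
    proof -
      have lin: "continuous_on ({0..1} \<times> K) (\<lambda>x. linepath a b (fst x))"
        unfolding linepath_def by (intro continuous_intros)
      have "continuous_on ({0..1} \<times> K) (\<lambda>x. f (linepath a b (fst x)))"
        by (rule continuous_on_compose2[OF assms(3) lin]) (use seg in auto)
      moreover have "linepath a b (fst x) - snd x \<noteq> 0" if "x \<in> {0..1} \<times> K" for x
        using seg[of "fst x"] assms(2) that by auto
      ultimately show ?thesis
        unfolding G_def split_beta by (intro continuous_intros lin) auto
    qed
    show "(\<lambda>z. G (t, z)) \<in> rational_poles_off K" if "t \<in> {0..1}" for t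
    proof -
      have "linepath a b t \<notin> K" using seg[of t] that assms(2) by auto
      from rational_poles_off_simple_pole[OF this, of "f (linepath a b t) * (b - a)"]
      show ?thesis by (simp add: G_def mult.commute)
    qed
  qed fact
  moreover have "integral {0..1} (\<lambda>t. G (t, z)) = cauchy_segment f a b z" for z
    by (simp add: cauchy_segment_def G_def contour_integral_integral)
  ultimately show ?thesis by simp
qed

text \<open>Differentiation under the integral sign even gives a complex derivative off the segment.
  Here \<open>norm (b - a)\<close> bounds the speed of \<open>linepath a b\<close>.\<close>

lemma isCont_cauchy_segment:
  assumes "z \<notin> closed_segment a b" "continuous_on (closed_segment a b) f"
  shows "isCont (cauchy_segment f a b) z"
proof (rule DERIV_isCont)
  show "(cauchy_segment f a b has_field_derivative
     1 * contour_integral (linepath a b) (\<lambda>w. f w / (w - z) ^ Suc 1)) (at z)"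
  proof -
    have "((\<lambda>u. f u / (u - w) ^ 1) has_contour_integral cauchy_segment f a b w) (linepath a b)"
      if "w \<in> UNIV - path_image (linepath a b)" for w
    proof -
      have "continuous_on (closed_segment a b) (\<lambda>u. f u / (u - w))"
        by (intro continuous_intros assms(2)) (use that in auto)
      then show ?thesis
        unfolding cauchy_segment_def power_one_right
        by (intro has_contour_integral_integral contour_integrable_continuous_linepath)
    qed
    then show ?thesis
      using Cauchy_next_derivative(2)[of "linepath a b" f "norm (b - a)" UNIV 1 "cauchy_segment f a b" z] assms
      by simp
  qed
qed

lemma cauchy_segment_swap: "cauchy_segment f b a z = - cauchy_segment f a b z"
  using contour_integral_reversepath[OF valid_path_linepath, of a b]
  by (simp add: cauchy_segment_def)

text \<open>The top and left sides are reversed so that every segment runs in the direction of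
  increasing coordinate. An edge shared by two neighboring squares then gives the same term with
  opposite signs.\<close>

lemma contour_integral_rectpath_cauchy_segment:
  assumes "(\<lambda>w. f w / (w - z)) contour_integrable_on rectpath a b"
  shows "contour_integral (rectpath a b) (\<lambda>w. f w / (w - z)) =
    cauchy_segment f a (Complex (Re b) (Im a)) z + cauchy_segment f (Complex (Re b) (Im a)) b z
    - cauchy_segment f (Complex (Re a) (Im b)) b z - cauchy_segment f a (Complex (Re a) (Im b)) z"
proof -
  have "contour_integral (rectpath a b) (\<lambda>w. f w / (w - z)) =
    cauchy_segment f a (Complex (Re b) (Im a)) z + (cauchy_segment f (Complex (Re b) (Im a)) b z
    + (cauchy_segment f b (Complex (Re a) (Im b)) z + cauchy_segment f (Complex (Re a) (Im b)) a z))"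
    using assms by (simp add: rectpath_def Let_def cauchy_segment_def)
  then show ?thesis
    using cauchy_segment_swap[of f b] cauchy_segment_swap[of f _ a] by simp
qed

lemma Cauchy_integral_formula_rectpath:
  assumes "f holomorphic_on cbox a b" "z \<in> box a b"
  shows "((\<lambda>w. f w / (w - z)) has_contour_integral (2 * pi * \<i> * f z)) (rectpath a b)"
proof -
  have ab: "Re a \<le> Re b" "Im a \<le> Im b"
    using assms(2) by (auto simp: in_box_complex_iff)
  have "((\<lambda>w. f w / (w - z)) has_contour_integral (2 * pi * \<i> * winding_number (rectpath a b) z * f z)) (rectpath a b)"
    by (rule Cauchy_integral_formula_convex_simple[where S = "cbox a b"])
      (use assms ab in \<open>auto simp: path_image_rectpath_cbox_minus_box\<close>)
  then show ?thesis using winding_number_rectpath[OF assms(2)] by simp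
qed

text \<open>With the pole outside, the integrand is holomorphic on the convex closed box.\<close>

lemma Cauchy_theorem_rectpath_outside:
  assumes "f holomorphic_on cbox a b" "z \<notin> cbox a b" "Re a \<le> Re b" "Im a \<le> Im b"
  shows "((\<lambda>w. f w / (w - z)) has_contour_integral 0) (rectpath a b)"
proof (rule Cauchy_theorem_convex_simple[where S = "cbox a b"])
  show "(\<lambda>w. f w / (w - z)) holomorphic_on cbox a b"
    using assms(2) by (intro holomorphic_intros assms(1)) auto
  show "path_image (rectpath a b) \<subseteq> cbox a b"
    by (rule path_image_rectpath_subset_cbox[OF assms(3,4)])
qed auto

section \<open>Runge's theorem by grid squares\<close>

text \<open>Brings sums over differently shifted squares to one index set with 0-1 weights, so that
  cancellation of shared edges can be read off from the coefficients.\<close>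

lemma sum_shift:
  fixes h :: "'a \<Rightarrow> 'b::comm_ring_1"
  assumes "finite A" "inj s" "s ` M \<subseteq> A"
  shows "(\<Sum>x\<in>M. h (s x)) = (\<Sum>x\<in>A. of_bool (x \<in> s ` M) * h x)"
proof -
  have "(\<Sum>x\<in>M. h (s x)) = (\<Sum>x\<in>s ` M. h x)"
    using assms(2) by (subst sum.reindex) (auto intro: inj_on_subset)
  also have "\<dots> = (\<Sum>x\<in>A. of_bool (x \<in> s ` M) * h x)"
    using assms by (intro sum.mono_neutral_cong_left) auto
  finally show ?thesis .
qed

theorem Runge_rational:
  assumes K: "compact K" and U: "open U" "K \<subseteq> U" and hol: "f holomorphic_on U"
  shows "rationally_approximable K f"
proof -
  obtain e where e: "e > 0" "(\<Union>x\<in>K. ball x e) \<subseteq> U"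
    using compact_subset_open_imp_ball_epsilon_subset[OF K U] by blast
  \<comment> \<open>Two points of a square of side \<open>d\<close> are at most
    \<open>2 * d < e\<close> apart, so every square meeting \<open>K\<close> stays inside
    \<open>U\<close>.\<close>
  define d where "d = e / 3"
  have d: "d > 0" using e by (simp add: d_def)
  define c where "c = (\<lambda>i j. Complex (d * of_int i) (d * of_int j))"
  define S where "S = (\<lambda>i j. cbox (c i j) (c (i + 1) (j + 1)))"
  \<comment> \<open>The squares are closed, so an edge that touches \<open>K\<close> has both of its
    adjacent squares in \<open>M\<close>.\<close>
  define M where "M = {(i, j). S i j \<inter> K \<noteq> {}}"
  have S_iff: "z \<in> S i j \<longleftrightarrow> d * of_int i \<le> Re z \<and> Re z \<le> d * (of_int i + 1) \<and>
      d * of_int j \<le> Im z \<and> Im z \<le> d * (of_int j + 1)" for z i j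
    by (auto simp: S_def c_def in_cbox_complex_iff)
  have SU: "S i j \<subseteq> U" if ij: "(i, j) \<in> M" for i j
  proof
    fix z assume z: "z \<in> S i j"
    obtain x where x: "x \<in> S i j" "x \<in> K" using ij unfolding M_def by blast
    have "dist x z \<le> \<bar>Re (x - z)\<bar> + \<bar>Im (x - z)\<bar>"
      unfolding dist_norm by (rule cmod_le)
    also have "\<dots> \<le> d + d"
      using x(1) z by (intro add_mono) (auto simp: S_iff algebra_simps)
    also have "\<dots> < e" using e(1) by (simp add: d_def)
    finally show "z \<in> U" using e(2) x(2) by (meson UN_subset_iff mem_ball subsetD)
  qed
  have finM: "finite M"
  proof -
    obtain B where B: "\<And>x. x \<in> K \<Longrightarrow> norm x \<le> B"
      using compact_imp_bounded[OF K] by (auto simp: bounded_iff)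
    \<comment> \<open>A closed grid interval that contains a coordinate of absolute value at most
      \<open>B\<close> has its index in a fixed finite range.\<close>
    have *: "i \<in> {\<lfloor>- B / d - 1\<rfloor>..\<lceil>B / d\<rceil>}"
      if "d * of_int i \<le> t" "t \<le> d * (of_int i + 1)" "\<bar>t\<bar> \<le> B" for i :: int and t
    proof -
      have "d * of_int i \<le> B" "- B \<le> d * (of_int i + 1)" using that by auto
      then have "of_int i \<le> B / d" "- B / d - 1 \<le> of_int i"
        using d by (auto simp: field_simps)
      then show ?thesis by (auto simp: floor_le_iff le_ceiling_iff) linarith+
    qed
    have "M \<subseteq> {\<lfloor>- B / d - 1\<rfloor>..\<lceil>B / d\<rceil>} \<times> {\<lfloor>- B / d - 1\<rfloor>..\<lceil>B / d\<rceil>}"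
    proof clarify
      fix i j assume "(i, j) \<in> M"
      then obtain x where x: "x \<in> S i j" "x \<in> K" unfolding M_def by blast
      then show "i \<in> {\<lfloor>- B / d - 1\<rfloor>..\<lceil>B / d\<rceil>} \<and> j \<in> {\<lfloor>- B / d - 1\<rfloor>..\<lceil>B / d\<rceil>}"
        using *[of i "Re x"] *[of j "Im x"] B[of x] abs_Re_le_cmod[of x] abs_Im_le_cmod[of x]
        unfolding S_iff by (meson order_trans)
    qed
    then show ?thesis by (rule finite_subset) simp
  qed
  \<comment> \<open>Edges are labeled by their lower or left endpoint: the top edge of square
    \<open>x\<close> is the bottom edge of \<open>up x\<close>, and its right edge is the left edge
    of \<open>right x\<close>.\<close>
  define up right where "up = (\<lambda>(i::int, j::int). (i, j + 1))" and "right = (\<lambda>(i::int, j::int). (i + 1, j))"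
  have inj: "inj up" "inj right" by (auto simp: up_def right_def inj_def)
  define A where "A = M \<union> up ` M \<union> right ` M"
  have finA: "finite A" using finM by (simp add: A_def)
  define H where "H = (\<lambda>(i, j). cauchy_segment f (c i j) (c (i + 1) j))"
  define V where "V = (\<lambda>(i, j). cauchy_segment f (c i j) (c i (j + 1)))"
  \<comment> \<open>The net multiplicity of a horizontal edge: +1 as the bottom of a square in
    \<open>M\<close>, -1 as the top of one. For vertical edges, \<open>\<beta>\<close> counts +1 as
    a right side and -1 as a left side.\<close>
  define \<alpha> where "\<alpha> = (\<lambda>x. of_bool (x \<in> M) - of_bool (x \<in> up ` M) :: complex)"
  define \<beta> where "\<beta> = (\<lambda>x. of_bool (x \<in> right ` M) - of_bool (x \<in> M) :: complex)"
  define G where "G = (\<lambda>z. (\<Sum>x\<in>A. \<alpha> x * H x z) + (\<Sum>x\<in>A. \<beta> x * V x z))"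
  have seg: "closed_segment p q \<subseteq> S i j" if "p \<in> S i j" "q \<in> S i j" for p q i j
    using that unfolding S_def by (intro closed_segment_subset) auto
  \<comment> \<open>An edge survives the cancellation only if exactly one of its two adjacent squares meets \<open>K\<close>.\<close>
  have edgeH: "closed_segment (c i j) (c (i + 1) j) \<inter> K = {} \<and> closed_segment (c i j) (c (i + 1) j) \<subseteq> U"
    if "\<alpha> (i, j) \<noteq> 0" for i j
  proof -
    have "(i, j) \<in> up ` M \<longleftrightarrow> (i, j - 1) \<in> M" by (force simp: up_def)
    with that have "((i, j) \<in> M) \<noteq> ((i, j - 1) \<in> M)" by (auto simp: \<alpha>_def)
    moreover have "closed_segment (c i j) (c (i + 1) j) \<subseteq> S i j" "closed_segment (c i j) (c (i + 1) j) \<subseteq> S i (j - 1)"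
      using d by (simp_all add: seg S_iff c_def)
    moreover have "S k l \<inter> K = {}" if "(k, l) \<notin> M" for k l
      using that by (auto simp: M_def)
    ultimately show ?thesis using SU by blast
  qed
  have edgeV: "closed_segment (c i j) (c i (j + 1)) \<inter> K = {} \<and> closed_segment (c i j) (c i (j + 1)) \<subseteq> U"
    if "\<beta> (i, j) \<noteq> 0" for i j
  proof -
    have "(i, j) \<in> right ` M \<longleftrightarrow> (i - 1, j) \<in> M" by (force simp: right_def)
    with that have "((i, j) \<in> M) \<noteq> ((i - 1, j) \<in> M)" by (auto simp: \<beta>_def)
    moreover have "closed_segment (c i j) (c i (j + 1)) \<subseteq> S i j" "closed_segment (c i j) (c i (j + 1)) \<subseteq> S (i - 1) j"
      using d by (simp_all add: seg S_iff c_def)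
    moreover have "S k l \<inter> K = {}" if "(k, l) \<notin> M" for k l
      using that by (auto simp: M_def)
    ultimately show ?thesis using SU by blast
  qed
  have contf: "continuous_on U f" using hol by (rule holomorphic_on_imp_continuous_on)
  \<comment> \<open>A point of an open square lies on no grid line, so the square
    \<open>(k, l)\<close> contributes the Cauchy value and every other square of \<open>M\<close>
    contributes 0.\<close>
  have G_inside: "G z = 2 * pi * \<i> * f z"
    if kl: "(k, l) \<in> M" and z: "z \<in> box (c k l) (c (k + 1) (l + 1))" for k l z
  proof -
    have square: "H (i, j) z + V (i + 1, j) z - H (i, j + 1) z - V (i, j) z =
        (if (i, j) = (k, l) then 2 * pi * \<i> * f z else 0)" if ij: "(i, j) \<in> M" for i j
    proof -
      have holS: "f holomorphic_on cbox (c i j) (c (i + 1) (j + 1))"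
        using SU[OF ij] hol unfolding S_def by (rule holomorphic_on_subset[rotated])
      have "((\<lambda>w. f w / (w - z)) has_contour_integral (if (i, j) = (k, l) then 2 * pi * \<i> * f z else 0))
          (rectpath (c i j) (c (i + 1) (j + 1)))"
      proof (cases "(i, j) = (k, l)")
        case True
        then show ?thesis using Cauchy_integral_formula_rectpath[OF holS] z by auto
      next
        case False
        have "z \<notin> S i j"
        proof
          assume zS: "z \<in> S i j"
          \<comment> \<open>An open and a closed grid interval sharing a point have equal index,
            because the two integers differ by less than 1.\<close>
          have *: "i = k" if "d * of_int i \<le> t" "t \<le> d * (of_int i + 1)" "d * of_int k < t" "t < d * (of_int k + 1)"
            for i k :: int and t
          proof -
            have "d * of_int i < d * (of_int k + 1)" "d * of_int k < d * (of_int i + 1)" using that by linarith+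
            then have "of_int i < (of_int k + 1 :: real)" "of_int k < (of_int i + 1 :: real)"
              using d by auto
            then show ?thesis by linarith
          qed
          have "i = k \<and> j = l"
            using z zS *[of i "Re z" k] *[of j "Im z" l]
            by (auto simp: S_iff in_box_complex_iff c_def)
          with False show False by simp
        qed
        then show ?thesis
          using False Cauchy_theorem_rectpath_outside[OF holS] d by (auto simp: S_def c_def)
      qed
      from contour_integral_unique[OF this]
        contour_integral_rectpath_cauchy_segment[OF has_contour_integral_integrable[OF this]]
      show ?thesis by (simp add: H_def V_def c_def)
    qed
    have "2 * pi * \<i> * f z = (\<Sum>x\<in>M. if x = (k, l) then 2 * pi * \<i> * f z else 0)"
      using finM kl by simp
    also have "\<dots> = (\<Sum>x\<in>M. H x z + V (right x) z - H (up x) z - V x z)"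
    proof (intro sum.cong refl)
      fix x assume x: "x \<in> M"
      obtain i j where ij: "x = (i, j)" by fastforce
      show "(if x = (k, l) then 2 * pi * \<i> * f z else 0) = H x z + V (right x) z - H (up x) z - V x z"
        using square[of i j] x unfolding ij up_def right_def by simp
    qed
    \<comment> \<open>Writing \<open>id\<close> gives the unshifted sums the form that
      \<open>sum_shift\<close> rewrites.\<close>
    also have "\<dots> = (\<Sum>x\<in>M. H (id x) z) + (\<Sum>x\<in>M. V (right x) z) - (\<Sum>x\<in>M. H (up x) z) - (\<Sum>x\<in>M. V (id x) z)"
      by (simp add: sum.distrib sum_subtractf)
    also have "\<dots> = G z"
      by (subst (1 2 3 4) sum_shift[OF finA])
        (auto simp: inj A_def G_def \<alpha>_def \<beta>_def sum_subtractf left_diff_distrib)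
    finally show ?thesis by simp
  qed
  have approxG: "rationally_approximable K G"
  proof -
    \<comment> \<open>Edges of coefficient 0 are treated separately: they may meet \<open>K\<close>,
      where the Cauchy integral is not under control.\<close>
    have "rationally_approximable K (\<lambda>z. \<alpha> x * H x z)" for x
    proof (cases "\<alpha> x = 0")
      case False
      then show ?thesis
        using edgeH[of "fst x" "snd x"] unfolding H_def split_beta
        by (intro rationally_approximable_cmult rationally_approximable_cauchy_segment K)
          (auto intro: continuous_on_subset[OF contf])
    qed (simp add: rationally_approximable_zero)
    moreover have "rationally_approximable K (\<lambda>z. \<beta> x * V x z)" for x
    proof (cases "\<beta> x = 0")
      case False
      then show ?thesis
        using edgeV[of "fst x" "snd x"] unfolding V_def split_beta
        by (intro rationally_approximable_cmult rationally_approximable_cauchy_segment K)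
          (auto intro: continuous_on_subset[OF contf])
    qed (simp add: rationally_approximable_zero)
    ultimately show ?thesis
      unfolding G_def by (intro rationally_approximable_add rationally_approximable_sum)
  qed
  \<comment> \<open>The surviving edges avoid \<open>K\<close>, so \<open>G\<close> is continuous
    even at points of \<open>K\<close> on grid lines. This carries the formula from open squares to
    their boundaries.\<close>
  have contG: "isCont G z" if "z \<in> K" for z
  proof -
    have "isCont (\<lambda>z. \<alpha> x * H x z) z" for x
    proof (cases "\<alpha> x = 0")
      case False
      then show ?thesis
        using edgeH[of "fst x" "snd x"] that unfolding H_def split_beta
        by (intro continuous_intros isCont_cauchy_segment)
          (auto intro: continuous_on_subset[OF contf])
    qed simp
    moreover have "isCont (\<lambda>z. \<beta> x * V x z) z" for x
    proof (cases "\<beta> x = 0")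
      case False
      then show ?thesis
        using edgeV[of "fst x" "snd x"] that unfolding V_def split_beta
        by (intro continuous_intros isCont_cauchy_segment)
          (auto intro: continuous_on_subset[OF contf])
    qed simp
    ultimately show ?thesis unfolding G_def by (intro continuous_add continuous_sum)
  qed
  have G_eq: "G z = 2 * pi * \<i> * f z" if z: "z \<in> K" for z
  proof -
    define k l where "k = \<lfloor>Re z / d\<rfloor>" and "l = \<lfloor>Im z / d\<rfloor>"
    have "d * of_int k \<le> Re z \<and> Re z \<le> d * (of_int k + 1)" "d * of_int l \<le> Im z \<and> Im z \<le> d * (of_int l + 1)"
      unfolding k_def l_def using d floor_divide_lower[of d] floor_divide_upper[of d]
      by (auto simp: mult.commute intro: less_imp_le)
    then have zS: "z \<in> S k l" by (simp add: S_iff)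
    then have kl: "(k, l) \<in> M" using z by (auto simp: M_def)
    define Q where "Q = box (c k l) (c (k + 1) (l + 1))"
    \<comment> \<open>The center shows that the open square is nonempty, so its closure is the
      closed square.\<close>
    have "c k l + Complex (d / 2) (d / 2) \<in> Q"
      using d by (auto simp: Q_def c_def in_box_complex_iff algebra_simps)
    then have "z \<in> closure Q" using zS closure_box unfolding Q_def S_def by fastforce
    then obtain x where x: "\<And>n. x n \<in> Q" "x \<longlonglongrightarrow> z" by (auto simp: closure_sequential)
    have "(\<lambda>n. G (x n)) \<longlonglongrightarrow> G z"
      using contG[OF z] x(2) by (rule isCont_tendsto_compose)
    then have "(\<lambda>n. 2 * pi * \<i> * f (x n)) \<longlonglongrightarrow> G z"
      using G_inside[OF kl] x(1) by (simp add: Q_def)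
    moreover have "isCont f z"
      using contf U z continuous_on_eq_continuous_at by blast
    then have "(\<lambda>n. 2 * pi * \<i> * f (x n)) \<longlonglongrightarrow> 2 * pi * \<i> * f z"
      using x(2) by (intro tendsto_intros isCont_tendsto_compose[of _ f])
    ultimately show ?thesis by (rule LIMSEQ_unique)
  qed
  have "rationally_approximable K (\<lambda>z. 1 / (2 * pi * \<i>) * G z)"
    using approxG by (rule rationally_approximable_cmult)
  then show ?thesis
    using G_eq by (simp add: rationally_approximable_def)
qed


section \<open>Subharmonicity of real-affine functions\<close>

text \<open>Continuity on the parameter interval makes the positive and negative parts integrable,
  so their extended difference is the ordinary integral.\<close>

lemma circle_mean_of_real:
  assumes cont: "continuous_on {0..2 * pi} (\<lambda>t. v (z + of_real r * cis t))"
  shows "circle_mean (\<lambda>z. ereal (v z)) z r =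
    ereal (integral {0..2 * pi} (\<lambda>t. v (z + of_real r * cis t)) / (2 * pi))"
proof -
  define \<phi> where "\<phi> = (\<lambda>t. v (z + of_real r * cis t) * indicator {0..2 * pi} t)"
  have si: "set_integrable lborel {0..2 * pi} (\<lambda>t. v (z + of_real r * cis t))"
    by (intro borel_integrable_atLeastAtMost' cont)
  then have int: "integrable lborel \<phi>"
    by (simp add: set_integrable_def \<phi>_def mult.commute)
  have fin: "(\<integral>\<^sup>+t. ennreal (\<phi> t) \<partial>lborel) < \<infinity>" "(\<integral>\<^sup>+t. ennreal (- \<phi> t) \<partial>lborel) < \<infinity>"
    using int by (auto simp: real_integrable_def less_top)
  have pos: "(\<integral>\<^sup>+t\<in>{0..2*pi}. e2ennreal (ereal (v (z + of_real r * cis t))) \<partial>lborel) = (\<integral>\<^sup>+t. ennreal (\<phi> t) \<partial>lborel)"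
    by (intro nn_integral_cong) (auto simp: \<phi>_def indicator_def)
  have neg: "(\<integral>\<^sup>+t\<in>{0..2*pi}. e2ennreal (- ereal (v (z + of_real r * cis t))) \<partial>lborel) = (\<integral>\<^sup>+t. ennreal (- \<phi> t) \<partial>lborel)"
    by (intro nn_integral_cong) (auto simp: \<phi>_def indicator_def)
  have enn: "enn2ereal x = ereal (enn2real x)" if "x < \<infinity>" for x
    using that by (cases x rule: ennreal_cases) auto
  have "integral {0..2 * pi} (\<lambda>t. v (z + of_real r * cis t)) = integral\<^sup>L lborel \<phi>"
    using set_borel_integral_eq_integral(2)[OF si]
    by (simp add: set_lebesgue_integral_def \<phi>_def mult.commute)
  then show ?thesis
    unfolding circle_mean_def pos neg enn[OF fin(1)] enn[OF fin(2)]
    by (simp add: real_lebesgue_integral_def[OF int])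
qed

text \<open>The mean value property holds with equality: on a circle, \<open>L\<close> adds to its
  central value only multiples of \<open>cos\<close> and \<open>sin\<close>, which integrate to 0
  over a period.\<close>

lemma subharmonic_real_affine:
  assumes "linear L"
  shows "subharmonic (\<lambda>\<zeta>. ereal (c + L \<zeta>))"
proof -
  have contL: "continuous_on A L" for A
    using assms linear_continuous_on linear_conv_bounded_linear by blast
  have "circle_mean (\<lambda>\<zeta>. ereal (c + L \<zeta>)) z r = ereal (c + L z)" for z r
  proof -
    have "L (z + of_real r * cis t) = L z + (r * cos t) * L 1 + (r * sin t) * L \<i>" for t
    proof -
      have "z + of_real r * cis t = z + (r * cos t) *\<^sub>R 1 + (r * sin t) *\<^sub>R \<i>"
        by (simp add: complex_eq_iff)
      then show ?thesis
        by (simp only: linear_add[OF assms] linear_scale[OF assms] real_scaleR_def)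
    qed
    \<comment> \<open>The value is left as antiderivative at \<open>2 * pi\<close> minus
      antiderivative at 0, the shape produced by the fundamental theorem.\<close>
    moreover have "((\<lambda>t. c + (L z + (r * cos t) * L 1 + (r * sin t) * L \<i>)) has_integral
      (((c + L z) * (2 * pi) + r * sin (2 * pi) * L 1 - r * cos (2 * pi) * L \<i>)
       - ((c + L z) * 0 + r * sin 0 * L 1 - r * cos 0 * L \<i>))) {0..2 * pi}"
      by (rule fundamental_theorem_of_calculus)
        (auto intro!: derivative_eq_intros simp: has_real_derivative_iff_has_vector_derivative[symmetric] algebra_simps)
    ultimately have "integral {0..2 * pi} (\<lambda>t. c + L (z + of_real r * cis t)) = (c + L z) * (2 * pi)"
      by (simp add: integral_unique)
    moreover have "continuous_on {0..2 * pi} (\<lambda>t. c + L (z + of_real r * cis t))"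
      by (intro continuous_intros continuous_on_compose2[OF contL[of UNIV]]) auto
    ultimately show ?thesis
      by (subst circle_mean_of_real) auto
  qed
  moreover have "open {z. ereal (c + L z) < x}" for x
    by (intro open_Collect_less continuous_intros contL)
  ultimately show ?thesis
    by (simp add: subharmonic_def upper_semicontinuous_def)
qed

text \<open>On a complex line this function is real-affine. Taking \<open>v\<close> in
  \<open>Basis\<close> yields the real coordinates, from which Euclidean boxes are cut out.\<close>

lemma plurisubharmonic_inner: "plurisubharmonic (\<lambda>x. ereal (x \<bullet> v))"
proof -
  have "subharmonic (\<lambda>\<zeta>. ereal ((a + \<zeta> *s b) \<bullet> v))" for a b :: "complex^'a"
  proof -
    have "linear (\<lambda>\<zeta>. (\<zeta> *s b) \<bullet> v)"
      by (intro linearI)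
        (auto simp: inner_vec_def scaleR_vec_def vector_scalar_mult_def algebra_simps sum_distrib_left sum.distrib)
    from subharmonic_real_affine[OF this, of "a \<bullet> v"] show ?thesis
      by (simp add: inner_add_left)
  qed
  moreover have "open {x. ereal (x \<bullet> v) < c}" for c
    by (intro open_Collect_less continuous_intros)
  ultimately show ?thesis
    by (simp add: plurisubharmonic_def upper_semicontinuous_def)
qed

section \<open>Comparison of the Euclidean, fine and plurifine topologies\<close>

lemma openin_coarsest_topology:
  assumes "u \<in> F" "open V"
  shows "openin (coarsest_topology F) (u -` V)"
  unfolding coarsest_topology_def
  using assms by (intro topology_generated_by_Basis) blast

text \<open>One member of the generating family suffices, as its preimage of \<open>UNIV\<close> is
  the whole space.\<close>

lemma topspace_plurifine_topology [simp]: "topspace plurifine_topology = UNIV"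
  using openin_subset[OF openin_coarsest_topology[OF _ open_UNIV, of _ "{u. plurisubharmonic u}"]]
    plurisubharmonic_inner
  by (force simp: plurifine_topology_def)

lemma topspace_fine_topology [simp]: "topspace fine_topology = UNIV"
  using openin_subset[OF openin_coarsest_topology[OF _ open_UNIV, of _ "{u. subharmonic u}"]]
    subharmonic_real_affine[OF linear_zero]
  by (force simp: fine_topology_def)

text \<open>A box is a finite intersection of strips, each the preimage of an open interval under a
  plurisubharmonic real coordinate.\<close>

lemma open_imp_openin_plurifine:
  assumes "open T"
  shows "openin plurifine_topology T"
proof (subst openin_subopen, intro ballI)
  fix x assume "x \<in> T"
  then obtain a b where ab: "x \<in> box a b" "box a b \<subseteq> T"
    using assms by (meson open_contains_box)
  have "openin plurifine_topology {y. a \<bullet> i < y \<bullet> i \<and> y \<bullet> i < b \<bullet> i}" for i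
  proof -
    have "openin plurifine_topology ((\<lambda>y. ereal (y \<bullet> i)) -` {ereal (a \<bullet> i)<..<ereal (b \<bullet> i)})"
      unfolding plurifine_topology_def
      by (intro openin_coarsest_topology) (auto simp: plurisubharmonic_inner)
    then show ?thesis by (simp add: vimage_def)
  qed
  then have "openin plurifine_topology (\<Inter>i\<in>Basis. {y. a \<bullet> i < y \<bullet> i \<and> y \<bullet> i < b \<bullet> i})"
    by (intro openin_Inter) auto
  moreover have "(\<Inter>i\<in>Basis. {y. a \<bullet> i < y \<bullet> i \<and> y \<bullet> i < b \<bullet> i}) = box a b"
    by (auto simp: box_def)
  ultimately show "\<exists>W. openin plurifine_topology W \<and> x \<in> W \<and> W \<subseteq> T"
    using ab by auto
qed

text \<open>Preimages under the parametrization commute with unions and intersections, so generating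
  sets suffice. For these, plurisubharmonic functions are subharmonic along lines by
  definition.\<close>

lemma openin_fine_line:
  assumes "openin plurifine_topology W"
  shows "openin fine_topology {\<zeta>. a + \<zeta> *s b \<in> W}"
proof -
  have "generate_topology_on {u -` V | u V. u \<in> {u. plurisubharmonic u} \<and> open V} W"
    using assms by (simp add: plurifine_topology_def coarsest_topology_def openin_topology_generated_by)
  then show ?thesis
  proof induction
    case (Int A B)
    then have "openin fine_topology ({\<zeta>. a + \<zeta> *s b \<in> A} \<inter> {\<zeta>. a + \<zeta> *s b \<in> B})"
      by (intro openin_Int)
    then show ?case by (simp add: Int_def)
  next
    case (UN \<K>)
    then have "openin fine_topology (\<Union>A\<in>\<K>. {\<zeta>. a + \<zeta> *s b \<in> A})"
      by (intro openin_Union) auto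
    moreover have "(\<Union>A\<in>\<K>. {\<zeta>. a + \<zeta> *s b \<in> A}) = {\<zeta>. a + \<zeta> *s b \<in> \<Union>\<K>}"
      by auto
    ultimately show ?case by simp
  next
    case (Basis s)
    then obtain u V where uV: "s = u -` V" "plurisubharmonic u" "open V" by blast
    then have "openin fine_topology ((\<lambda>\<zeta>. u (a + \<zeta> *s b)) -` V)"
      unfolding fine_topology_def
      by (intro openin_coarsest_topology) (auto simp: plurisubharmonic_def)
    then show ?case using uV(1) by (simp add: vimage_def)
  qed simp
qed

section \<open>Restriction to complex lines\<close>

lemma continuous_on_line: "continuous_on A (\<lambda>\<zeta>::complex. a + \<zeta> *s b)"
  unfolding vector_scalar_mult_def by (intro continuous_intros)

text \<open>A coordinate with \<open>b $ i\<close> nonzero recovers the parameter continuously from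
  the point, so the section lies in a compact image of \<open>K\<close>. It is also closed.\<close>

lemma compact_line_section:
  fixes b :: "complex^'n"
  assumes "compact K" "b \<noteq> 0"
  shows "compact {\<zeta>. a + \<zeta> *s b \<in> K}"
proof -
  obtain i where i: "b $ i \<noteq> 0" using assms(2) by (auto simp: vec_eq_iff)
  have "compact ((\<lambda>x. (x $ i - a $ i) / b $ i) ` K)"
    using i by (intro compact_continuous_image assms continuous_intros) auto
  moreover have "{\<zeta>. a + \<zeta> *s b \<in> K} \<subseteq> (\<lambda>x. (x $ i - a $ i) / b $ i) ` K"
  proof
    fix \<zeta> assume "\<zeta> \<in> {\<zeta>. a + \<zeta> *s b \<in> K}"
    then show "\<zeta> \<in> (\<lambda>x. (x $ i - a $ i) / b $ i) ` K"
      using i by (intro image_eqI[of _ _ "a + \<zeta> *s b"]) auto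
  qed
  moreover have "closed {\<zeta>. a + \<zeta> *s b \<in> K}"
    using continuous_closed_vimage[OF compact_imp_closed[OF assms(1)], of "\<lambda>\<zeta>. a + \<zeta> *s b"]
      continuous_on_line[of UNIV a b]
    by (simp add: vimage_def continuous_on_eq_continuous_at)
  ultimately show ?thesis
    by (meson bounded_subset compact_eq_bounded_closed)
qed

text \<open>By the chain rule the real derivative sends \<open>\<zeta>\<close> to
  \<open>D (\<zeta> *s b)\<close>; complex homogeneity of \<open>D\<close> turns this into
  multiplication by \<open>D b\<close>.\<close>

lemma holomorphic_on_line:
  assumes "holomorphic_Cn_on h U"
  shows "(\<lambda>\<zeta>. h (a + \<zeta> *s b)) holomorphic_on {\<zeta>. a + \<zeta> *s b \<in> U}"
  unfolding holomorphic_on_def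
proof clarify
  fix \<zeta> assume "a + \<zeta> *s b \<in> U"
  then obtain D where D: "(h has_derivative D) (at (a + \<zeta> *s b))" "\<And>c v. D (c *s v) = c * D v"
    using assms unfolding holomorphic_Cn_on_def by meson
  have "bounded_linear (\<lambda>\<zeta>::complex. \<zeta> *s b)"
    unfolding linear_conv_bounded_linear[symmetric]
    by (intro linearI) (auto simp: vec_eq_iff algebra_simps)
  then have "((\<lambda>\<zeta>. a + \<zeta> *s b) has_derivative (\<lambda>\<zeta>. \<zeta> *s b)) (at \<zeta>)"
    by (auto intro!: derivative_eq_intros bounded_linear_imp_has_derivative)
  from diff_chain_at[OF this D(1)]
  have "((\<lambda>\<zeta>. h (a + \<zeta> *s b)) has_field_derivative D b) (at \<zeta>)"
    by (simp add: has_field_derivative_def o_def D(2) mult_commute_abs)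
  then show "(\<lambda>\<zeta>. h (a + \<zeta> *s b)) field_differentiable (at \<zeta> within {\<zeta>. a + \<zeta> *s b \<in> U})"
    using field_differentiable_at_within field_differentiable_def by blast
qed

text \<open>Half of the error is spent on an element of \<open>H0_alg K\<close>, the other half on
  Runge's theorem for its holomorphic extension along the line.\<close>

lemma H_alg_line_uniform_limit:
  fixes a b :: "complex^'n"
  assumes "compact K" "b \<noteq> 0" "f \<in> H_alg K"
  defines "K' \<equiv> {\<zeta>. a + \<zeta> *s b \<in> K}"
  obtains R where "\<And>k::nat. R k \<in> rational_poles_off K'"
    "uniform_limit K' R (\<lambda>\<zeta>. f (a + \<zeta> *s b)) sequentially"
proof -
  have K': "compact K'"
    unfolding K'_def by (rule compact_line_section[OF assms(1,2)])
  have "\<exists>r\<in>rational_poles_off K'. \<forall>\<zeta>\<in>K'. dist (r \<zeta>) (f (a + \<zeta> *s b)) < e" if "e > 0" for e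
  proof -
    obtain g where g: "g \<in> H0_alg K" "\<And>z. z \<in> K \<Longrightarrow> dist (g z) (f z) < e / 2"
      using assms(3) \<open>e > 0\<close> unfolding H_alg_def by (force dest: spec[of _ "e / 2"])
    then obtain U h where h: "open U" "K \<subseteq> U" "holomorphic_Cn_on h U" "\<And>z. z \<in> K \<Longrightarrow> g z = h z"
      by (auto simp: H0_alg_def)
    have "open {\<zeta>. a + \<zeta> *s b \<in> U}"
      using continuous_open_vimage[OF h(1), of "\<lambda>\<zeta>. a + \<zeta> *s b"] continuous_on_line[of UNIV a b]
      by (simp add: vimage_def continuous_on_eq_continuous_at)
    then have "rationally_approximable K' (\<lambda>\<zeta>. h (a + \<zeta> *s b))"
      using K' h(2) by (intro Runge_rational[OF _ _ _ holomorphic_on_line[OF h(3)]]) (auto simp: K'_def)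
    then obtain r where r: "r \<in> rational_poles_off K'" "\<And>\<zeta>. \<zeta> \<in> K' \<Longrightarrow> dist (r \<zeta>) (h (a + \<zeta> *s b)) \<le> e / 2"
      using \<open>e > 0\<close> unfolding rationally_approximable_def by (meson half_gt_zero)
    have "dist (r \<zeta>) (f (a + \<zeta> *s b)) < e" if "\<zeta> \<in> K'" for \<zeta>
    proof -
      have "dist (h (a + \<zeta> *s b)) (f (a + \<zeta> *s b)) < e / 2"
        using that g(2) h(4) by (force simp: K'_def)
      then show ?thesis
        using r(2)[OF that] dist_triangle[of "r \<zeta>" "f (a + \<zeta> *s b)" "h (a + \<zeta> *s b)"] by linarith
    qed
    with r(1) show ?thesis by blast
  qed
  then have "\<forall>k. \<exists>r\<in>rational_poles_off K'. \<forall>\<zeta>\<in>K'. dist (r \<zeta>) (f (a + \<zeta> *s b)) < inverse (real (Suc k))"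
    by simp
  then obtain R where R: "\<And>k. R k \<in> rational_poles_off K'"
      "\<And>k \<zeta>. \<zeta> \<in> K' \<Longrightarrow> dist (R k \<zeta>) (f (a + \<zeta> *s b)) < inverse (real (Suc k))"
    by metis
  have "uniform_limit K' R (\<lambda>\<zeta>. f (a + \<zeta> *s b)) sequentially"
    unfolding uniform_limit_iff
  proof (intro allI impI)
    fix e :: real assume "e > 0"
    then have "\<forall>\<^sub>F k in sequentially. inverse (real (Suc k)) < e"
      using LIMSEQ_inverse_real_of_nat order_tendstoD(2) by blast
    then show "\<forall>\<^sub>F k in sequentially. \<forall>\<zeta>\<in>K'. dist (R k \<zeta>) (f (a + \<zeta> *s b)) < e"
      by (rule eventually_mono) (meson R(2) order_less_trans)
  qed
  with R(1) show ?thesis by (rule that)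
qed

section \<open>Plurifine continuity and fine holomorphy on lines\<close>

lemma strongly_F_holomorphic_imp_F_continuous:
  assumes "openin plurifine_topology \<Omega>" "strongly_F_holomorphic f \<Omega>"
  shows "F_continuous f \<Omega>"
proof -
  have "openin plurifine_topology {x \<in> \<Omega>. f x \<in> V}" if V: "open V" for V
  proof (subst openin_subopen, intro ballI)
    fix z assume z: "z \<in> {x \<in> \<Omega>. f x \<in> V}"
    then obtain K where K: "z \<in> plurifine_topology interior_of K" "K \<subseteq> \<Omega>" "f \<in> H_alg K"
      using assms(2) unfolding strongly_F_holomorphic_def by blast
    have "continuous_on K f" using K(3) by (simp add: H_alg_def)
    then obtain T where T: "open T" "T \<inter> K = f -` V \<inter> K"
      using V by (meson continuous_on_open_invariant)
    let ?W = "plurifine_topology interior_of K"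
    have "?W \<subseteq> K" by (rule interior_of_subset)
    \<comment> \<open>Euclidean continuity controls \<open>f\<close> only relative to
      \<open>K\<close>; intersecting \<open>T\<close> with the plurifine interior of
      \<open>K\<close> gives a genuine plurifine neighborhood.\<close>
    then have "z \<in> T \<inter> ?W" "T \<inter> ?W \<subseteq> {x \<in> \<Omega>. f x \<in> V}"
      using z K T(2) by auto
    moreover have "openin plurifine_topology (T \<inter> ?W)"
      by (intro openin_Int open_imp_openin_plurifine T openin_interior_of)
    ultimately show "\<exists>W. openin plurifine_topology W \<and> z \<in> W \<and> W \<subseteq> {x \<in> \<Omega>. f x \<in> V}"
      by blast
  qed
  then have "openin (subtopology plurifine_topology \<Omega>) {x \<in> \<Omega>. f x \<in> V}" if "open V" for V
    using that by (auto simp: openin_open_subtopology[OF assms(1)])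
  then show ?thesis
    by (simp add: F_continuous_def continuous_map_def)
qed

lemma strongly_F_holomorphic_imp_finely_holomorphic_line:
  fixes b :: "complex^'n"
  assumes "openin plurifine_topology \<Omega>" "strongly_F_holomorphic f \<Omega>" "b \<noteq> 0"
  shows "finely_holomorphic (\<lambda>\<zeta>. f (a + \<zeta> *s b)) {\<zeta>. a + \<zeta> *s b \<in> \<Omega>}"
  unfolding finely_holomorphic_def
proof (intro conjI ballI)
  show "openin fine_topology {\<zeta>. a + \<zeta> *s b \<in> \<Omega>}"
    by (rule openin_fine_line[OF assms(1)])
  fix \<zeta> assume "\<zeta> \<in> {\<zeta>. a + \<zeta> *s b \<in> \<Omega>}"
  then obtain K where K: "compact K" "a + \<zeta> *s b \<in> plurifine_topology interior_of K" "K \<subseteq> \<Omega>" "f \<in> H_alg K"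
    using assms(2) unfolding strongly_F_holomorphic_def by blast
  let ?K' = "{\<zeta>. a + \<zeta> *s b \<in> K}"
  \<comment> \<open>The trace of the plurifine interior is finely open and contained in the section,
    hence lies in the fine interior of the section.\<close>
  have "{\<zeta>. a + \<zeta> *s b \<in> plurifine_topology interior_of K} \<subseteq> fine_topology interior_of ?K'"
    by (intro interior_of_maximal openin_fine_line openin_interior_of)
      (use interior_of_subset in fastforce)
  then have "\<zeta> \<in> fine_topology interior_of ?K'" using K(2) by auto
  moreover have "compact ?K'" by (rule compact_line_section[OF K(1) assms(3)])
  moreover have "?K' \<subseteq> {\<zeta>. a + \<zeta> *s b \<in> \<Omega>}" using K(3) by auto
  moreover obtain R where "\<And>k::nat. R k \<in> rational_poles_off ?K'"
    "uniform_limit ?K' R (\<lambda>\<zeta>. f (a + \<zeta> *s b)) sequentially"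
    using H_alg_line_uniform_limit[OF K(1) assms(3) K(4)] by blast
  ultimately show "\<exists>K. compact K \<and> \<zeta> \<in> fine_topology interior_of K \<and> K \<subseteq> {\<zeta>. a + \<zeta> *s b \<in> \<Omega>} \<and>
      (\<exists>R. (\<forall>k. R k \<in> rational_poles_off K) \<and> uniform_limit K R (\<lambda>\<zeta>. f (a + \<zeta> *s b)) sequentially)"
    by blast
qed

theorem proposition2p7:
  fixes \<Omega> :: "(complex^'n) set" and f :: "complex^'n \<Rightarrow> complex"
  assumes "openin plurifine_topology \<Omega>"
    and "strongly_F_holomorphic f \<Omega>"
  shows "weakly_F_holomorphic f \<Omega> \<and> F_continuous f \<Omega>"
  using strongly_F_holomorphic_imp_F_continuous[OF assms]
    strongly_F_holomorphic_imp_finely_holomorphic_line[OF assms]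
  by (simp add: weakly_F_holomorphic_def)

end
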